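(* Let $L$ be a positive even integer, and let $\Theta_L$ be the ground state of $H_L^{\mathrm{FM}}$ in the spin singlet sector, normalized so that $\|\Theta_L\|=1$. For $\ell\in\{1,\dots,L-1\}$ define the single mode approximation (SMA) trial energy $$\mathcal{E}^{\mathrm{SMA}}_{L}(\ell)=\frac{\left\langle\Theta_L,\ \widehat{S}^-_{-\ell}\left(H_L^{\mathrm{FM}}-E^{\mathrm{FM}}_{\min}(0;L)\right)\widehat{S}^+_{\ell}\,\Theta_L\right\rangle}{\left\|\widehat{S}^+_{\ell}\Theta_L\right\|^2}.$$ Then $$\mathcal{E}^{\mathrm{SMA}}_{L}(\ell)=\frac{8}{3}\left(\frac{L}{4}-E^{\mathrm{FM}}_{\min}(0;L)\right)\frac{\sin^2(\pi\ell/L)}{\left\|\widehat{S}^+_{\ell}\Theta_L\right\|^2}.$$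
   Context: Let $L$ be even and $\mathcal{H}_{\mathrm{tot}}=(\mathbb{C}^2)^{\otimes L}$, with tensor factors (sites) labelled $1,\dots,L$. On $\mathbb{C}^2$ with orthonormal basis $\Psi_{1/2,1/2},\Psi_{1/2,-1/2}$, let $S^{(1)}=\begin{bmatrix}0&1/2\\1/2&0\end{bmatrix}$, $S^{(2)}=\begin{bmatrix}0&-i/2\\i/2&0\end{bmatrix}$, $S^{(3)}=\begin{bmatrix}1/2&0\\0&-1/2\end{bmatrix}$, $S^{\pm}=S^{(1)}\pm iS^{(2)}$; $S^{(\nu)}_\alpha$ and $S^\pm_\alpha$ denote these operators acting on the $\alpha$-th tensor factor (identity on the others). The Heisenberg ferromagnet on the ring is $$H_L^{\mathrm{FM}}=\sum_{\alpha=1}^{L}\Big(\tfrac14\mathbf{1}-S^{(1)}_\alpha S^{(1)}_{[\alpha+1]}-S^{(2)}_\alpha S^{(2)}_{[\alpha+1]}-S^{(3)}_\alpha S^{(3)}_{[\alpha+1]}\Big),$$ where $[\alpha+1]=\alpha+1$ for $\alpha<L$ and $[L+1]=1$. Let $S^{(\nu)}_{\mathrm{tot}}=\sum_{\alpha=1}^L S^{(\nu)}_\alpha$, $\mathcal{C}_{\mathrm{tot}}=\sum_{\nu=1}^3 (S^{(\nu)}_{\mathrm{tot}})^2$, and let $\mathcal{H}_{\mathrm{tot}}(0)=\{\psi\in\mathcal{H}_{\mathrm{tot}}:\mathcal{C}_{\mathrm{tot}}\psi=0\}$ (the spin singlet sector), which is invariant under $H_L^{\mathrm{FM}}$. Let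 $$E_{\min}^{\mathrm{FM}}(0;L)=\min\left\{\frac{\langle\psi,H_L^{\mathrm{FM}}\psi\rangle}{\|\psi\|^2}:\psi\in\mathcal{H}_{\mathrm{tot}}(0),\ \psi\neq0\right\}.$$ The eigenspace $\{\psi\in\mathcal{H}_{\mathrm{tot}}(0):H_L^{\mathrm{FM}}\psi=E_{\min}^{\mathrm{FM}}(0;L)\psi\}$ is one-dimensional, and $\Theta_L$ denotes a vector spanning it. For $\ell\in\mathbb{Z}$ the momentum-$\ell$ spin raising and lowering operators are $$\widehat{S}^{\pm}_\ell=\sum_{\alpha=1}^{L}e^{2\pi i\ell\alpha/L}S^{\pm}_\alpha .$$ *)

theory Defs
  imports "HOL-Analysis.Analysis"
begin

text \<open>
  The index type \<open>2\<close> labels the basis of the single-site space: \<open>1\<close> is spin up (\<open>m = 1/2\<close>),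
  \<open>2\<close> is spin down (\<open>m = -1/2\<close>).  An element of the \<open>L\<close>-fold tensor power is represented
  by its coefficients in the orthonormal product basis, which is indexed by the
  configurations \<open>\<sigma> : {1..L} \<rightarrow> 2\<close>; coefficients outside this index set are zero.
\<close>

type_synonym config = "nat \<Rightarrow> 2"
type_synonym state = "config \<Rightarrow> complex"

definition configs :: "nat \<Rightarrow> config set" where
  "configs L = {1..L} \<rightarrow>\<^sub>E UNIV"

definition H_tot :: "nat \<Rightarrow> state set" where
  "H_tot L = {\<psi>. \<forall>\<sigma>. \<sigma> \<notin> configs L \<longrightarrow> \<psi> \<sigma> = 0}"

text \<open>Conjugate-linear in the first argument.\<close>

definition cip :: "nat \<Rightarrow> state \<Rightarrow> state \<Rightarrow> complex" where
  "cip L \<phi> \<psi> = (\<Sum>\<sigma>\<in>configs L. cnj (\<phi> \<sigma>) * \<psi> \<sigma>)"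

definition hnorm :: "nat \<Rightarrow> state \<Rightarrow> real" where
  "hnorm L \<psi> = sqrt (Re (cip L \<psi> \<psi>))"

definition S1 :: "complex ^ 2 ^ 2" where
  "S1 = vector [vector [0, 1/2], vector [1/2, 0]]"

definition S2 :: "complex ^ 2 ^ 2" where
  "S2 = vector [vector [0, - \<i>/2], vector [\<i>/2, 0]]"

definition S3 :: "complex ^ 2 ^ 2" where
  "S3 = vector [vector [1/2, 0], vector [0, - 1/2]]"

definition Splus :: "complex ^ 2 ^ 2" where
  "Splus = (\<chi> i j. S1 $ i $ j + \<i> * S2 $ i $ j)"

definition Sminus :: "complex ^ 2 ^ 2" where
  "Sminus = (\<chi> i j. S1 $ i $ j - \<i> * S2 $ i $ j)"

text \<open>
  The operator acting as \<open>A\<close> on tensor factor \<open>\<alpha>\<close> and as the identity on the others.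
  For \<open>\<alpha> \<in> {1..L}\<close> it maps \<open>H_tot L\<close> to itself, since changing \<open>\<sigma>\<close> at \<open>\<alpha>\<close> does not affect
  membership in \<open>configs L\<close>.
\<close>

definition site_op :: "complex ^ 2 ^ 2 \<Rightarrow> nat \<Rightarrow> state \<Rightarrow> state" where
  "site_op A \<alpha> \<psi> = (\<lambda>\<sigma>. \<Sum>s\<in>UNIV. A $ (\<sigma> \<alpha>) $ s * \<psi> (\<sigma>(\<alpha> := s)))"

definition next_site :: "nat \<Rightarrow> nat \<Rightarrow> nat" where
  "next_site L \<alpha> = (if \<alpha> = L then 1 else \<alpha> + 1)"

definition H_FM :: "nat \<Rightarrow> state \<Rightarrow> state" where
  "H_FM L \<psi> = (\<lambda>\<sigma>. \<Sum>\<alpha>\<in>{1..L}.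
      1/4 * \<psi> \<sigma>
      - site_op S1 \<alpha> (site_op S1 (next_site L \<alpha>) \<psi>) \<sigma>
      - site_op S2 \<alpha> (site_op S2 (next_site L \<alpha>) \<psi>) \<sigma>
      - site_op S3 \<alpha> (site_op S3 (next_site L \<alpha>) \<psi>) \<sigma>)"

definition tot_op :: "nat \<Rightarrow> complex ^ 2 ^ 2 \<Rightarrow> state \<Rightarrow> state" where
  "tot_op L A \<psi> = (\<lambda>\<sigma>. \<Sum>\<alpha>\<in>{1..L}. site_op A \<alpha> \<psi> \<sigma>)"

definition C_tot :: "nat \<Rightarrow> state \<Rightarrow> state" where
  "C_tot L \<psi> = (\<lambda>\<sigma>. tot_op L S1 (tot_op L S1 \<psi>) \<sigma>
                   + tot_op L S2 (tot_op L S2 \<psi>) \<sigma>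
                   + tot_op L S3 (tot_op L S3 \<psi>) \<sigma>)"

definition singlets :: "nat \<Rightarrow> state set" where
  "singlets L = {\<psi> \<in> H_tot L. C_tot L \<psi> = (\<lambda>_. 0)}"

text \<open>
  The Rayleigh quotients are real because \<open>H_FM\<close> is self-adjoint, so taking the real part
  loses nothing.
\<close>

definition E_min_FM :: "nat \<Rightarrow> real" where
  "E_min_FM L = (LEAST E. \<exists>\<psi>\<in>singlets L. \<psi> \<noteq> (\<lambda>_. 0) \<and>
      E = Re (cip L \<psi> (H_FM L \<psi>)) / (hnorm L \<psi>)\<^sup>2)"

definition ground_space :: "nat \<Rightarrow> state set" where
  "ground_space L = {\<psi> \<in> singlets L. H_FM L \<psi> = (\<lambda>\<sigma>. of_real (E_min_FM L) * \<psi> \<sigma>)}"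

definition Shat :: "nat \<Rightarrow> complex ^ 2 ^ 2 \<Rightarrow> int \<Rightarrow> state \<Rightarrow> state" where
  "Shat L A l \<psi> = (\<lambda>\<sigma>. \<Sum>\<alpha>\<in>{1..L}.
      exp (2 * of_real pi * \<i> * of_int l * of_nat \<alpha> / of_nat L) * site_op A \<alpha> \<psi> \<sigma>)"

abbreviation Shat_plus :: "nat \<Rightarrow> int \<Rightarrow> state \<Rightarrow> state" where
  "Shat_plus L \<equiv> Shat L Splus"

abbreviation Shat_minus :: "nat \<Rightarrow> int \<Rightarrow> state \<Rightarrow> state" where
  "Shat_minus L \<equiv> Shat L Sminus"

text \<open>
  Complex-valued; reality of the quotient is not built into the definition.
  If \<open>Shat_plus L l \<Theta>\<close> vanishes, the quotient is \<open>0\<close> by the convention \<open>x / 0 = 0\<close>.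
\<close>

definition E_SMA :: "nat \<Rightarrow> state \<Rightarrow> int \<Rightarrow> complex" where
  "E_SMA L \<Theta> l =
     cip L \<Theta> (Shat_minus L (- l)
        (\<lambda>\<sigma>. H_FM L (Shat_plus L l \<Theta>) \<sigma> - of_real (E_min_FM L) * Shat_plus L l \<Theta> \<sigma>))
     / of_real ((hnorm L (Shat_plus L l \<Theta>))\<^sup>2)"

end

theory Submission
  imports Defs
begin

text \<open>
  Write \<open>A\<close> for the raising operator of momentum \<open>l\<close> and \<open>A\<^sup>*\<close> for its adjoint.  Flipping all
  spins and conjugating the coefficients is an antiunitary symmetry of \<open>H\<close> and of the singlet
  sector that exchanges \<open>A\<close> and \<open>A\<^sup>*\<close>.  Since the ground space is one-dimensional, this symmetry
  fixes \<open>\<Theta>\<close> up to a phase, so \<open>\<langle>A\<Theta>, (H - E) A\<Theta>\<rangle> = \<langle>A\<^sup>*\<Theta>, (H - E) A\<^sup>*\<Theta>\<rangle>\<close>, and both equal half of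
  the expectation of the double commutator \<open>[A\<^sup>*, [H, A]]\<close>.  The double commutator is a sum over
  the bonds; in a singlet every bond contributes \<open>4 \<langle>S3\<^sub>a S3\<^sub>b\<rangle> = 4/3 \<langle>S\<^sub>a \<cdot> S\<^sub>b\<rangle>\<close> times the
  squared modulus \<open>4 sin\<^sup>2 (\<pi> l / L)\<close> of the difference of the Fourier weights at its ends.
\<close>

section \<open>Operators on the product space\<close>

lemma spin_entries:
  "S1 $ 1 $ 1 = 0" "S1 $ 1 $ 2 = 1/2" "S1 $ 2 $ 1 = 1/2" "S1 $ 2 $ 2 = 0"
  "S2 $ 1 $ 1 = 0" "S2 $ 1 $ 2 = - \<i>/2" "S2 $ 2 $ 1 = \<i>/2" "S2 $ 2 $ 2 = 0"
  "S3 $ 1 $ 1 = 1/2" "S3 $ 1 $ 2 = 0" "S3 $ 2 $ 1 = 0" "S3 $ 2 $ 2 = - 1/2"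
  "Splus $ 1 $ 1 = 0" "Splus $ 1 $ 2 = 1" "Splus $ 2 $ 1 = 0" "Splus $ 2 $ 2 = 0"
  "Sminus $ 1 $ 1 = 0" "Sminus $ 1 $ 2 = 0" "Sminus $ 2 $ 1 = 1" "Sminus $ 2 $ 2 = 0"
  by (simp_all add: S1_def S2_def S3_def Splus_def Sminus_def)

text \<open>Linearity is required on all functions, not only on \<open>H_tot L\<close>, so operators
  can be rearranged without membership side conditions.\<close>

definition linop :: "(state \<Rightarrow> state) \<Rightarrow> bool" where
  "linop T \<longleftrightarrow> (\<forall>f g. T (\<lambda>\<sigma>. f \<sigma> + g \<sigma>) = (\<lambda>\<sigma>. T f \<sigma> + T g \<sigma>))
    \<and> (\<forall>c f. T (\<lambda>\<sigma>. c * f \<sigma>) = (\<lambda>\<sigma>. c * T f \<sigma>))"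

lemma linopI:
  assumes "\<And>f g \<sigma>. T (\<lambda>\<sigma>. f \<sigma> + g \<sigma>) \<sigma> = T f \<sigma> + T g \<sigma>"
    and "\<And>c f \<sigma>. T (\<lambda>\<sigma>. c * f \<sigma>) \<sigma> = c * T f \<sigma>"
  shows "linop T"
  using assms by (auto simp: linop_def)

lemma linop_add: "linop T \<Longrightarrow> T (\<lambda>\<sigma>. f \<sigma> + g \<sigma>) = (\<lambda>\<sigma>. T f \<sigma> + T g \<sigma>)"
  by (simp add: linop_def)

lemma linop_scale: "linop T \<Longrightarrow> T (\<lambda>\<sigma>. c * f \<sigma>) = (\<lambda>\<sigma>. c * T f \<sigma>)"
  by (simp add: linop_def)

lemma linop_zero: "linop T \<Longrightarrow> T (\<lambda>\<sigma>. 0) = (\<lambda>\<sigma>. 0)"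
  using linop_scale[of T 0 "\<lambda>_. 0"] by simp

lemma linop_diff:
  assumes "linop T"
  shows "T (\<lambda>\<sigma>. f \<sigma> - g \<sigma>) = (\<lambda>\<sigma>. T f \<sigma> - T g \<sigma>)"
  using linop_add[OF assms, of f "\<lambda>\<sigma>. (-1) * g \<sigma>"] linop_scale[OF assms, of "-1" g] by simp

lemma linop_sum:
  assumes "linop T" and "finite I"
  shows "T (\<lambda>\<sigma>. \<Sum>i\<in>I. c i * f i \<sigma>) = (\<lambda>\<sigma>. \<Sum>i\<in>I. c i * T (f i) \<sigma>)"
  using assms(2)
proof induction
  case empty
  show ?case
    by (simp add: linop_zero[OF assms(1)])
next
  case (insert i I)
  then show ?case
    using linop_add[OF assms(1), of "\<lambda>\<sigma>. c i * f i \<sigma>" "\<lambda>\<sigma>. \<Sum>i\<in>I. c i * f i \<sigma>"]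
    by (simp add: linop_scale[OF assms(1)])
qed

lemma linop_comp: "linop T \<Longrightarrow> linop U \<Longrightarrow> linop (\<lambda>\<psi>. T (U \<psi>))"
  by (simp add: linop_def)

lemma linop_minus_op: "linop T \<Longrightarrow> linop U \<Longrightarrow> linop (\<lambda>\<psi> \<sigma>. T \<psi> \<sigma> - U \<psi> \<sigma>)"
  by (simp add: linop_def algebra_simps)

lemma linop_scale_op: "linop T \<Longrightarrow> linop (\<lambda>\<psi> \<sigma>. c * T \<psi> \<sigma>)"
  by (simp add: linop_def algebra_simps)

lemma linop_id: "linop (\<lambda>\<psi>. \<psi>)"
  by (simp add: linop_def)

lemma linop_sum_op: "(\<And>i. linop (T i)) \<Longrightarrow> linop (\<lambda>\<psi> \<sigma>. \<Sum>i\<in>I. T i \<psi> \<sigma>)"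
  by (simp add: linop_def sum.distrib sum_distrib_left)

section \<open>One-site operators and their weighted sums\<close>

lemma linop_site_op: "linop (site_op A a)"
  by (rule linopI) (simp_all add: site_op_def algebra_simps sum.distrib sum_distrib_left)

lemma site_op_commute:
  assumes "a \<noteq> b"
  shows "site_op A a (site_op B b \<psi>) = site_op B b (site_op A a \<psi>)"
proof
  fix \<sigma>
  show "site_op A a (site_op B b \<psi>) \<sigma> = site_op B b (site_op A a \<psi>) \<sigma>"
    using assms by (simp add: site_op_def sum_2 fun_upd_twist algebra_simps)
qed

text \<open>A common form for total spin (constant weight 1) and the momentum operators (Fourier
  weights), so that adjoints, commutators and symmetries are computed once for arbitrary
  weights.\<close>

definition wop :: "nat \<Rightarrow> (nat \<Rightarrow> complex) \<Rightarrow> complex ^ 2 ^ 2 \<Rightarrow> state \<Rightarrow> state" where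
  "wop L w A \<psi> = (\<lambda>\<sigma>. \<Sum>c\<in>{1..L}. w c * site_op A c \<psi> \<sigma>)"

lemma tot_op_wop: "tot_op L A = wop L (\<lambda>_. 1) A"
  by (simp add: wop_def tot_op_def fun_eq_iff)

lemma linop_wop: "linop (wop L w A)"
  unfolding wop_def by (intro linop_sum_op linop_scale_op linop_site_op)

text \<open>An operator \<open>X\<close> living on the sites \<open>a\<close> and \<open>b\<close>
  commutes with every other summand, so only two terms of the commutator survive.\<close>

lemma wop_commutator:
  assumes X: "linop X"
    and local: "\<And>c \<phi>. c \<in> {1..L} - {a, b} \<Longrightarrow> site_op A c (X \<phi>) = X (site_op A c \<phi>)"
    and ab: "a \<in> {1..L}" "b \<in> {1..L}" "a \<noteq> b"
  shows "wop L w A (X \<psi>) \<sigma> - X (wop L w A \<psi>) \<sigma>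
    = w a * (site_op A a (X \<psi>) \<sigma> - X (site_op A a \<psi>) \<sigma>)
      + w b * (site_op A b (X \<psi>) \<sigma> - X (site_op A b \<psi>) \<sigma>)"
proof -
  have "wop L w A (X \<psi>) \<sigma> - X (wop L w A \<psi>) \<sigma>
    = (\<Sum>c\<in>{1..L}. w c * (site_op A c (X \<psi>) \<sigma> - X (site_op A c \<psi>) \<sigma>))"
    unfolding wop_def by (simp add: linop_sum[OF X] sum_subtractf algebra_simps)
  also have "\<dots> = (\<Sum>c\<in>{a, b}. w c * (site_op A c (X \<psi>) \<sigma> - X (site_op A c \<psi>) \<sigma>))"
    by (rule sum.mono_neutral_right) (use ab local in auto)
  finally show ?thesis
    using ab by simp
qed

section \<open>Inner product and adjoints\<close>

lemma finite_configs: "finite (configs L)"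
  unfolding configs_def by (rule finite_PiE) simp_all

lemma fun_upd_configs_iff:
  assumes "a \<in> {1..L}"
  shows "\<sigma>(a := s) \<in> configs L \<longleftrightarrow> \<sigma> \<in> configs L"
  using assms by (auto simp: configs_def PiE_iff extensional_def)

lemma cip_add_right: "cip L \<phi> (\<lambda>\<sigma>. f \<sigma> + g \<sigma>) = cip L \<phi> f + cip L \<phi> g"
  by (simp add: cip_def algebra_simps sum.distrib)

lemma cip_diff_right: "cip L \<phi> (\<lambda>\<sigma>. f \<sigma> - g \<sigma>) = cip L \<phi> f - cip L \<phi> g"
  by (simp add: cip_def algebra_simps sum_subtractf)

lemma cip_scale_right: "cip L \<phi> (\<lambda>\<sigma>. c * f \<sigma>) = c * cip L \<phi> f"
  by (simp add: cip_def algebra_simps sum_distrib_left)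

lemma cip_scale_left: "cip L (\<lambda>\<sigma>. c * f \<sigma>) \<phi> = cnj c * cip L f \<phi>"
  by (simp add: cip_def algebra_simps sum_distrib_left)

lemma cip_diff_left: "cip L (\<lambda>\<sigma>. f \<sigma> - g \<sigma>) \<phi> = cip L f \<phi> - cip L g \<phi>"
  by (simp add: cip_def algebra_simps sum_subtractf)

lemma cip_sum_right: "cip L \<phi> (\<lambda>\<sigma>. \<Sum>i\<in>I. f i \<sigma>) = (\<Sum>i\<in>I. cip L \<phi> (f i))"
  unfolding cip_def sum_distrib_left by (rule sum.swap)

lemma cip_sum_left: "cip L (\<lambda>\<sigma>. \<Sum>i\<in>I. f i \<sigma>) \<phi> = (\<Sum>i\<in>I. cip L (f i) \<phi>)"
  unfolding cip_def cnj_sum sum_distrib_right by (rule sum.swap)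

lemma cip_zero: "cip L \<phi> (\<lambda>_. 0) = 0" "cip L (\<lambda>_. 0) \<phi> = 0"
  by (simp_all add: cip_def)

lemma cip_cnj: "cnj (cip L \<phi> \<psi>) = cip L \<psi> \<phi>"
  by (simp add: cip_def mult.commute)

lemma cip_self: "cip L \<psi> \<psi> = of_real (\<Sum>\<sigma>\<in>configs L. (cmod (\<psi> \<sigma>))\<^sup>2)"
  unfolding cip_def of_real_sum complex_norm_square by (simp add: mult.commute)

lemma cip_self_Re: "cip L \<psi> \<psi> = of_real (Re (cip L \<psi> \<psi>))"
  by (simp add: cip_self)

lemma cip_self_nonneg: "Re (cip L \<psi> \<psi>) \<ge> 0"
  by (simp add: cip_self sum_nonneg)

lemma cip_self_hnorm: "cip L \<psi> \<psi> = of_real ((hnorm L \<psi>)\<^sup>2)"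
  by (subst cip_self_Re) (simp add: hnorm_def cip_self_nonneg)

text \<open>\<open>cip\<close> sees only coefficients on \<open>configs L\<close>; membership in
  \<open>H_tot L\<close> takes care of the others.\<close>

lemma cip_self_eq_0D:
  assumes "Re (cip L \<psi> \<psi>) = 0" and "\<psi> \<in> H_tot L"
  shows "\<psi> = (\<lambda>_. 0)"
proof
  fix \<sigma>
  have "\<forall>\<sigma>\<in>configs L. (cmod (\<psi> \<sigma>))\<^sup>2 = 0"
    using assms(1) by (subst (asm) cip_self) (simp add: sum_nonneg_eq_0_iff finite_configs)
  then show "\<psi> \<sigma> = 0"
    using assms(2) by (cases "\<sigma> \<in> configs L") (auto simp: H_tot_def)
qed

definition adj2 :: "complex ^ 2 ^ 2 \<Rightarrow> complex ^ 2 ^ 2" where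
  "adj2 A = (\<chi> i j. cnj (A $ j $ i))"

lemma adj2_spin: "adj2 S1 = S1" "adj2 S2 = S2" "adj2 S3 = S3" "adj2 Splus = Sminus"
  "adj2 Sminus = Splus"
  by (simp_all add: adj2_def vec_eq_iff forall_2 spin_entries)

lemma cip_site_op:
  assumes "a \<in> {1..L}"
  shows "cip L \<phi> (site_op A a \<psi>) = cip L (site_op (adj2 A) a \<phi>) \<psi>"
proof -
  have "cip L \<phi> (site_op A a \<psi>)
    = (\<Sum>(\<sigma>, s)\<in>configs L \<times> UNIV. cnj (\<phi> \<sigma>) * (A $ \<sigma> a $ s * \<psi> (\<sigma>(a := s))))"
    by (simp add: cip_def site_op_def sum_distrib_left sum.cartesian_product)
  also have "\<dots> = (\<Sum>(\<sigma>, s)\<in>configs L \<times> UNIV. cnj (adj2 A $ \<sigma> a $ s * \<phi> (\<sigma>(a := s))) * \<psi> \<sigma>)"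
    \<comment> \<open>The involution exchanges the spin at \<open>a\<close> with the summation
      variable \<open>s\<close>, which transposes the matrix.\<close>
    by (rule sum.reindex_bij_witness[of _ "\<lambda>(\<sigma>, s). (\<sigma>(a := s), \<sigma> a)" "\<lambda>(\<sigma>, s). (\<sigma>(a := s), \<sigma> a)"])
      (auto simp: fun_upd_configs_iff[OF assms] adj2_def)
  also have "\<dots> = cip L (site_op (adj2 A) a \<phi>) \<psi>"
    by (simp add: cip_def site_op_def sum_distrib_right sum.cartesian_product)
  finally show ?thesis .
qed

lemma cip_wop: "cip L \<phi> (wop L w A \<psi>) = cip L (wop L (\<lambda>c. cnj (w c)) (adj2 A) \<phi>) \<psi>"
  unfolding wop_def by (simp add: cip_sum_left cip_sum_right cip_scale_left cip_scale_right cip_site_op)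

lemma site_op_H_tot: "a \<in> {1..L} \<Longrightarrow> \<psi> \<in> H_tot L \<Longrightarrow> site_op A a \<psi> \<in> H_tot L"
  by (simp add: H_tot_def site_op_def fun_upd_configs_iff)

lemma wop_H_tot: "\<psi> \<in> H_tot L \<Longrightarrow> wop L w A \<psi> \<in> H_tot L"
  using site_op_H_tot[of _ L \<psi> A] by (simp add: H_tot_def wop_def)

section \<open>The Heisenberg bond operator\<close>

definition bond :: "nat \<Rightarrow> nat \<Rightarrow> state \<Rightarrow> state" where
  "bond a b \<psi> = (\<lambda>\<sigma>. 1/4 * \<psi> \<sigma> - site_op S1 a (site_op S1 b \<psi>) \<sigma>
      - site_op S2 a (site_op S2 b \<psi>) \<sigma> - site_op S3 a (site_op S3 b \<psi>) \<sigma>)"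

lemma H_FM_bond: "H_FM L \<psi> = (\<lambda>\<sigma>. \<Sum>a\<in>{1..L}. bond a (next_site L a) \<psi> \<sigma>)"
  by (simp add: H_FM_def bond_def)

lemma linop_bond: "linop (bond a b)"
  unfolding bond_def by (rule linopI) (simp_all add: linop_add[OF linop_site_op] linop_scale[OF linop_site_op] algebra_simps)

lemma linop_H_FM: "linop (H_FM L)"
  unfolding H_FM_bond by (intro linop_sum_op linop_bond)

lemma bond_site_op_commute:
  assumes "c \<noteq> a" "c \<noteq> b"
  shows "site_op A c (bond a b \<psi>) = bond a b (site_op A c \<psi>)"
proof -
  have *: "site_op A c (site_op B a (site_op C b \<psi>)) = site_op B a (site_op C b (site_op A c \<psi>))" for B C
    using assms by (simp add: site_op_commute[of c])
  show ?thesis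
    unfolding bond_def
    by (simp only: linop_diff[OF linop_site_op] linop_scale[OF linop_site_op] *)
qed

text \<open>This is the commutator of \<open>bond a b\<close> with the raising operator at
  \<open>a\<close>.\<close>

definition bond_comm :: "nat \<Rightarrow> nat \<Rightarrow> state \<Rightarrow> state" where
  "bond_comm a b \<psi> = (\<lambda>\<sigma>. site_op S3 a (site_op Splus b \<psi>) \<sigma> - site_op Splus a (site_op S3 b \<psi>) \<sigma>)"

lemma linop_bond_comm: "linop (bond_comm a b)"
  unfolding bond_comm_def by (rule linopI) (simp_all add: linop_add[OF linop_site_op] linop_scale[OF linop_site_op] algebra_simps)

lemma bond_comm_site_op_commute:
  assumes "c \<noteq> a" "c \<noteq> b"
  shows "site_op A c (bond_comm a b \<psi>) = bond_comm a b (site_op A c \<psi>)"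
proof -
  have *: "site_op A c (site_op B a (site_op C b \<psi>)) = site_op B a (site_op C b (site_op A c \<psi>))" for B C
    using assms by (simp add: site_op_commute[of c])
  show ?thesis
    unfolding bond_comm_def by (simp only: linop_diff[OF linop_site_op] *)
qed

text \<open>The signs are opposite because the bond is rotation invariant and so commutes with the
  sum of the two raising operators. The identities are checked on the four values of the spins at
  \<open>a\<close> and \<open>b\<close>.\<close>

lemma bond_Splus:
  assumes "a \<noteq> b"
  shows "site_op Splus a (bond a b \<psi>) \<sigma> - bond a b (site_op Splus a \<psi>) \<sigma> = - bond_comm a b \<psi> \<sigma>"
    and "site_op Splus b (bond a b \<psi>) \<sigma> - bond a b (site_op Splus b \<psi>) \<sigma> = bond_comm a b \<psi> \<sigma>"
  using assms exhaust_2[of "\<sigma> a"] exhaust_2[of "\<sigma> b"]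
  by (auto simp: bond_def bond_comm_def site_op_def sum_2 spin_entries fun_upd_twist[OF assms] algebra_simps)

text \<open>The outer layer of the double commutator; it reflects the one-site relations [S-, S3] =
  S- and [S-, S+] = -2 S3.\<close>

lemma bond_comm_Sminus:
  assumes "a \<noteq> b"
  shows "site_op Sminus a (bond_comm a b \<psi>) \<sigma> - bond_comm a b (site_op Sminus a \<psi>) \<sigma>
      = site_op Sminus a (site_op Splus b \<psi>) \<sigma> + 2 * site_op S3 a (site_op S3 b \<psi>) \<sigma>"
    and "site_op Sminus b (bond_comm a b \<psi>) \<sigma> - bond_comm a b (site_op Sminus b \<psi>) \<sigma>
      = - (site_op Splus a (site_op Sminus b \<psi>) \<sigma> + 2 * site_op S3 a (site_op S3 b \<psi>) \<sigma>)"
  using assms exhaust_2[of "\<sigma> a"] exhaust_2[of "\<sigma> b"]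
  by (auto simp: bond_comm_def site_op_def sum_2 spin_entries fun_upd_twist[OF assms] algebra_simps)

lemma S3_Splus_Sminus:
  assumes "a \<noteq> b"
  shows "site_op Sminus a (site_op S3 a (site_op Splus b \<psi>)) \<sigma>
        - site_op S3 a (site_op Splus b (site_op Sminus a \<psi>)) \<sigma>
      = site_op Sminus a (site_op Splus b \<psi>) \<sigma>"
    and "site_op Sminus b (site_op S3 a (site_op Splus b \<psi>)) \<sigma>
        - site_op S3 a (site_op Splus b (site_op Sminus b \<psi>)) \<sigma>
      = - 2 * site_op S3 a (site_op S3 b \<psi>) \<sigma>"
  using assms exhaust_2[of "\<sigma> a"] exhaust_2[of "\<sigma> b"]
  by (auto simp: site_op_def sum_2 spin_entries fun_upd_twist[OF assms] algebra_simps)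

text \<open>The transverse part S1 S1 + S2 S2 equals half of S+ S- plus S- S+.\<close>

lemma bond_ladder:
  assumes "a \<noteq> b"
  shows "bond a b \<psi> \<sigma> = 1/4 * \<psi> \<sigma> - 1/2 * site_op Sminus a (site_op Splus b \<psi>) \<sigma>
    - 1/2 * site_op Splus a (site_op Sminus b \<psi>) \<sigma> - site_op S3 a (site_op S3 b \<psi>) \<sigma>"
  using assms exhaust_2[of "\<sigma> a"] exhaust_2[of "\<sigma> b"]
  by (auto simp: bond_def site_op_def sum_2 spin_entries fun_upd_twist[OF assms] algebra_simps)

text \<open>A single site would be its own neighbour, hence the bound. For \<open>L = 2\<close> the
  same pair is simply counted twice, once in each order.\<close>

lemma next_site_props:
  assumes "L \<ge> 2" "a \<in> {1..L}"
  shows "next_site L a \<in> {1..L}" "next_site L a \<noteq> a"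
  using assms by (auto simp: next_site_def)

lemma cip_bond:
  assumes "a \<in> {1..L}" "b \<in> {1..L}" "a \<noteq> b"
  shows "cip L \<phi> (bond a b \<psi>) = cip L (bond a b \<phi>) \<psi>"
  using assms unfolding bond_def
  by (simp add: cip_diff_left cip_diff_right cip_scale_left cip_scale_right cip_site_op adj2_spin
      site_op_commute[of b a] del: times_divide_eq_left)

lemma cip_H_FM:
  assumes "L \<ge> 2"
  shows "cip L \<phi> (H_FM L \<psi>) = cip L (H_FM L \<phi>) \<psi>"
  unfolding H_FM_bond cip_sum_left cip_sum_right
  by (intro sum.cong refl cip_bond next_site_props[OF assms] next_site_props(2)[OF assms, THEN not_sym])

text \<open>Each bond sees only the weights at its two ends, and these enter with opposite signs;
  what remains is the discrete derivative of \<open>w\<close> along the ring.\<close>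

lemma H_FM_wop_Splus:
  assumes "L \<ge> 2"
  shows "H_FM L (wop L w Splus \<psi>) \<sigma> - wop L w Splus (H_FM L \<psi>) \<sigma>
    = (\<Sum>a\<in>{1..L}. (w a - w (next_site L a)) * bond_comm a (next_site L a) \<psi> \<sigma>)"
proof -
  have "wop L w Splus (H_FM L \<psi>) = (\<lambda>\<sigma>. \<Sum>a\<in>{1..L}. wop L w Splus (bond a (next_site L a) \<psi>) \<sigma>)"
    using linop_sum[OF linop_wop, of "{1..L}" L w Splus "\<lambda>_. 1" "\<lambda>a. bond a (next_site L a) \<psi>"]
    unfolding H_FM_bond by simp
  then have "H_FM L (wop L w Splus \<psi>) \<sigma> - wop L w Splus (H_FM L \<psi>) \<sigma>
    = (\<Sum>a\<in>{1..L}. - (wop L w Splus (bond a (next_site L a) \<psi>) \<sigma>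
        - bond a (next_site L a) (wop L w Splus \<psi>) \<sigma>))"
    by (simp add: H_FM_bond sum_subtractf)
  also have "\<dots> = (\<Sum>a\<in>{1..L}. (w a - w (next_site L a)) * bond_comm a (next_site L a) \<psi> \<sigma>)"
  proof (rule sum.cong)
    fix a assume a: "a \<in> {1..L}"
    note n = next_site_props[OF assms a]
    show "- (wop L w Splus (bond a (next_site L a) \<psi>) \<sigma> - bond a (next_site L a) (wop L w Splus \<psi>) \<sigma>)
      = (w a - w (next_site L a)) * bond_comm a (next_site L a) \<psi> \<sigma>"
      by (subst wop_commutator[where a = a and b = "next_site L a"])
        (use a n n(2)[symmetric] in \<open>auto simp: linop_bond bond_site_op_commute bond_Splus algebra_simps\<close>)
  qed simp
  finally show ?thesis .
qed

section \<open>Singlets\<close>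

text \<open>The components of total spin are self-adjoint, so the expectation of
  \<open>C_tot\<close> is a sum of three squared norms; as it is zero, each of them
  vanishes.\<close>

lemma singlet_tot_op:
  assumes "\<psi> \<in> singlets L"
  shows "tot_op L S1 \<psi> = (\<lambda>_. 0)" "tot_op L S2 \<psi> = (\<lambda>_. 0)" "tot_op L S3 \<psi> = (\<lambda>_. 0)"
proof -
  have sq: "cip L \<psi> (tot_op L A (tot_op L A \<psi>)) = cip L (tot_op L A \<psi>) (tot_op L A \<psi>)"
    if "adj2 A = A" for A
    using cip_wop[of L \<psi> "\<lambda>_. 1" A] that by (simp add: tot_op_wop)
  have "cip L \<psi> (C_tot L \<psi>) = 0"
    using assms by (simp add: singlets_def cip_zero)
  then have "cip L (tot_op L S1 \<psi>) (tot_op L S1 \<psi>) + cip L (tot_op L S2 \<psi>) (tot_op L S2 \<psi>)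
    + cip L (tot_op L S3 \<psi>) (tot_op L S3 \<psi>) = 0"
    by (simp add: C_tot_def cip_add_right sq adj2_spin)
  then have "Re (cip L (tot_op L S1 \<psi>) (tot_op L S1 \<psi>)) + Re (cip L (tot_op L S2 \<psi>) (tot_op L S2 \<psi>))
    + Re (cip L (tot_op L S3 \<psi>) (tot_op L S3 \<psi>)) = 0"
    by (metis plus_complex.sel(1) zero_complex.sel(1))
  then have "Re (cip L (tot_op L S1 \<psi>) (tot_op L S1 \<psi>)) = 0"
    "Re (cip L (tot_op L S2 \<psi>) (tot_op L S2 \<psi>)) = 0" "Re (cip L (tot_op L S3 \<psi>) (tot_op L S3 \<psi>)) = 0"
    using cip_self_nonneg[of L "tot_op L S1 \<psi>"] cip_self_nonneg[of L "tot_op L S2 \<psi>"]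
      cip_self_nonneg[of L "tot_op L S3 \<psi>"] by linarith+
  then show "tot_op L S1 \<psi> = (\<lambda>_. 0)" "tot_op L S2 \<psi> = (\<lambda>_. 0)" "tot_op L S3 \<psi> = (\<lambda>_. 0)"
    using assms by (auto intro!: cip_self_eq_0D wop_H_tot simp: tot_op_wop singlets_def)
qed

lemma singlet_ladder:
  assumes "\<psi> \<in> singlets L"
  shows "tot_op L Splus \<psi> = (\<lambda>_. 0)" "tot_op L Sminus \<psi> = (\<lambda>_. 0)"
proof -
  have "site_op Splus a \<psi> \<sigma> = site_op S1 a \<psi> \<sigma> + \<i> * site_op S2 a \<psi> \<sigma>"
    "site_op Sminus a \<psi> \<sigma> = site_op S1 a \<psi> \<sigma> - \<i> * site_op S2 a \<psi> \<sigma>" for a \<sigma>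
    by (simp_all add: site_op_def Splus_def Sminus_def sum_2 algebra_simps)
  then have "tot_op L Splus \<psi> = (\<lambda>\<sigma>. tot_op L S1 \<psi> \<sigma> + \<i> * tot_op L S2 \<psi> \<sigma>)"
    "tot_op L Sminus \<psi> = (\<lambda>\<sigma>. tot_op L S1 \<psi> \<sigma> - \<i> * tot_op L S2 \<psi> \<sigma>)"
    by (simp_all add: tot_op_def fun_eq_iff sum.distrib sum_subtractf sum_distrib_left)
  then show "tot_op L Splus \<psi> = (\<lambda>_. 0)" "tot_op L Sminus \<psi> = (\<lambda>_. 0)"
    by (simp_all add: singlet_tot_op[OF assms])
qed

text \<open>
  In a singlet the expectation of the commutator of the total lowering operator with
  \<open>S3\<close> at \<open>a\<close> times \<open>Splus\<close> at \<open>b\<close> vanishes.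
\<close>

lemma singlet_correlation:
  assumes \<psi>: "\<psi> \<in> singlets L" and ab: "a \<in> {1..L}" "b \<in> {1..L}" "a \<noteq> b"
  shows "cip L \<psi> (site_op Sminus a (site_op Splus b \<psi>)) = 2 * cip L \<psi> (site_op S3 a (site_op S3 b \<psi>))"
proof -
  define X where "X = (\<lambda>\<phi>. site_op S3 a (site_op Splus b \<phi>))"
  have X: "linop X"
    unfolding X_def by (simp add: linop_comp linop_site_op)
  have local: "site_op Sminus c (X \<phi>) = X (site_op Sminus c \<phi>)" if "c \<in> {1..L} - {a, b}" for c \<phi>
    using that by (simp add: X_def site_op_commute[of c])
  have "wop L (\<lambda>_. 1) Sminus (X \<psi>) \<sigma> - X (wop L (\<lambda>_. 1) Sminus \<psi>) \<sigma>
      = site_op Sminus a (site_op Splus b \<psi>) \<sigma> - 2 * site_op S3 a (site_op S3 b \<psi>) \<sigma>" for \<sigma>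
    by (subst wop_commutator[OF X local ab]) (simp_all add: X_def S3_Splus_Sminus ab)
  moreover have "X (wop L (\<lambda>_. 1) Sminus \<psi>) = (\<lambda>_. 0)"
    using singlet_ladder[OF \<psi>] by (simp add: tot_op_wop linop_zero[OF X])
  \<comment> \<open>Moved to the left slot, the total lowering operator becomes the total raising
    operator, which annihilates \<psi> as well.\<close>
  moreover have "cip L \<psi> (wop L (\<lambda>_. 1) Sminus (X \<psi>)) = 0"
    using singlet_ladder[OF \<psi>] by (simp add: cip_wop adj2_spin tot_op_wop cip_zero)
  ultimately have "wop L (\<lambda>_. 1) Sminus (X \<psi>)
      = (\<lambda>\<sigma>. site_op Sminus a (site_op Splus b \<psi>) \<sigma> - 2 * site_op S3 a (site_op S3 b \<psi>) \<sigma>)"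
    "cip L \<psi> (wop L (\<lambda>_. 1) Sminus (X \<psi>)) = 0"
    by auto
  then show ?thesis
    by (simp add: cip_diff_right cip_scale_right)
qed

section \<open>Complex conjugation combined with the spin flip\<close>

definition flip2 :: "2 \<Rightarrow> 2" where
  "flip2 s = (if s = 1 then 2 else 1)"

lemma flip2_flip2 [simp]: "flip2 (flip2 s) = s"
  using exhaust_2[of s] by (auto simp: flip2_def)

text \<open>Sites outside the ring are left alone, since there a configuration must keep its default
  value.\<close>

definition flip :: "nat \<Rightarrow> config \<Rightarrow> config" where
  "flip L \<sigma> = (\<lambda>a. if a \<in> {1..L} then flip2 (\<sigma> a) else \<sigma> a)"

lemma flip_flip [simp]: "flip L (flip L \<sigma>) = \<sigma>"
  by (auto simp: flip_def)

lemma flip_configs_iff [simp]: "flip L \<sigma> \<in> configs L \<longleftrightarrow> \<sigma> \<in> configs L"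
  by (auto simp: flip_def configs_def PiE_iff extensional_def)

lemma flip_upd: "a \<in> {1..L} \<Longrightarrow> flip L (\<sigma>(a := s)) = (flip L \<sigma>)(a := flip2 s)"
  by (auto simp: flip_def)

text \<open>An antiunitary involution, different from time reversal: it fixes S1 and S2, negates S3,
  and thereby exchanges raising and lowering operators.\<close>

definition conj_flip :: "nat \<Rightarrow> state \<Rightarrow> state" where
  "conj_flip L \<psi> = (\<lambda>\<sigma>. cnj (\<psi> (flip L \<sigma>)))"

definition conj_flip2 :: "complex ^ 2 ^ 2 \<Rightarrow> complex ^ 2 ^ 2" where
  "conj_flip2 A = (\<chi> i j. cnj (A $ flip2 i $ flip2 j))"

lemma conj_flip2_spin: "conj_flip2 S1 = S1" "conj_flip2 S2 = S2" "conj_flip2 S3 = - S3"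
  "conj_flip2 Splus = Sminus"
  by (simp_all add: conj_flip2_def flip2_def vec_eq_iff forall_2 spin_entries)

lemma cip_conj_flip: "cip L (conj_flip L \<phi>) (conj_flip L \<psi>) = cnj (cip L \<phi> \<psi>)"
  unfolding cip_def conj_flip_def cnj_sum
  by (rule sum.reindex_bij_witness[of _ "flip L" "flip L"]) auto

lemma conj_flip_site_op:
  assumes "a \<in> {1..L}"
  shows "conj_flip L (site_op A a \<psi>) = site_op (conj_flip2 A) a (conj_flip L \<psi>)"
proof
  fix \<sigma>
  have "flip L \<sigma> a = flip2 (\<sigma> a)"
    using assms by (simp add: flip_def)
  then show "conj_flip L (site_op A a \<psi>) \<sigma> = site_op (conj_flip2 A) a (conj_flip L \<psi>) \<sigma>"
    by (simp add: conj_flip_def site_op_def conj_flip2_def flip_upd[OF assms] sum_2)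
      (simp add: flip2_def)
qed

lemma site_op_uminus: "site_op (- A) a \<psi> = (\<lambda>\<sigma>. - site_op A a \<psi> \<sigma>)"
  by (simp add: site_op_def sum_negf)

lemma site_op_uminus_arg: "site_op A a (\<lambda>\<sigma>. - \<psi> \<sigma>) = (\<lambda>\<sigma>. - site_op A a \<psi> \<sigma>)"
  by (simp add: site_op_def sum_negf)

lemma conj_flip_wop: "conj_flip L (wop L w A \<psi>) = wop L (\<lambda>c. cnj (w c)) (conj_flip2 A) (conj_flip L \<psi>)"
proof
  fix \<sigma>
  show "conj_flip L (wop L w A \<psi>) \<sigma> = wop L (\<lambda>c. cnj (w c)) (conj_flip2 A) (conj_flip L \<psi>) \<sigma>"
    by (simp add: wop_def conj_flip_def fun_cong[OF conj_flip_site_op, unfolded conj_flip_def])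
qed

lemma conj_flip_tot_op: "conj_flip L (tot_op L A \<psi>) = tot_op L (conj_flip2 A) (conj_flip L \<psi>)"
  by (simp add: tot_op_wop conj_flip_wop)

text \<open>The sign picked up by S3 occurs twice in the bond and cancels.\<close>

lemma conj_flip_bond:
  assumes "a \<in> {1..L}" "b \<in> {1..L}"
  shows "conj_flip L (bond a b \<psi>) = bond a b (conj_flip L \<psi>)"
proof -
  have "site_op S3 a (site_op S3 b (conj_flip L \<psi>)) = conj_flip L (site_op S3 a (site_op S3 b \<psi>))"
    using assms by (simp add: conj_flip_site_op conj_flip2_spin site_op_uminus site_op_uminus_arg)
  moreover have "site_op A a (site_op A b (conj_flip L \<psi>)) = conj_flip L (site_op A a (site_op A b \<psi>))"
    if "conj_flip2 A = A" for A
    using assms that by (simp add: conj_flip_site_op)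
  ultimately show ?thesis
    by (simp add: bond_def conj_flip2_spin fun_eq_iff) (simp add: conj_flip_def)
qed

lemma conj_flip_H_FM:
  assumes "L \<ge> 2"
  shows "conj_flip L (H_FM L \<psi>) = H_FM L (conj_flip L \<psi>)"
proof
  fix \<sigma>
  have "H_FM L (conj_flip L \<psi>) \<sigma> = (\<Sum>a\<in>{1..L}. conj_flip L (bond a (next_site L a) \<psi>) \<sigma>)"
    unfolding H_FM_bond using next_site_props[OF assms]
    by (intro sum.cong) (auto simp: conj_flip_bond)
  then show "conj_flip L (H_FM L \<psi>) \<sigma> = H_FM L (conj_flip L \<psi>) \<sigma>"
    by (simp add: H_FM_bond conj_flip_def)
qed

lemma conj_flip_singlets:
  assumes "\<psi> \<in> singlets L"
  shows "conj_flip L \<psi> \<in> singlets L"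
proof -
  have zero: "conj_flip L (\<lambda>_. 0) = (\<lambda>_. 0)"
    by (simp add: conj_flip_def)
  have "tot_op L S1 (conj_flip L \<psi>) = (\<lambda>_. 0)" "tot_op L S2 (conj_flip L \<psi>) = (\<lambda>_. 0)"
    "tot_op L (- S3) (conj_flip L \<psi>) = (\<lambda>_. 0)"
    using singlet_tot_op[OF assms, THEN arg_cong, of "conj_flip L"]
    by (simp_all add: conj_flip_tot_op conj_flip2_spin zero)
  moreover from this(3) have "tot_op L S3 (conj_flip L \<psi>) = (\<lambda>_. 0)"
    by (simp add: tot_op_def site_op_uminus sum_negf fun_eq_iff)
  moreover have "tot_op L A (\<lambda>_. 0) = (\<lambda>_. 0)" for A
    by (simp add: tot_op_wop linop_zero linop_wop)
  moreover have "conj_flip L \<psi> \<in> H_tot L"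
    using assms by (auto simp: singlets_def H_tot_def conj_flip_def)
  ultimately show ?thesis
    by (simp add: singlets_def C_tot_def)
qed

text \<open>The eigenvalue is real, so complex conjugation does not change it.\<close>

lemma conj_flip_ground_space:
  assumes "L \<ge> 2" and "\<psi> \<in> ground_space L"
  shows "conj_flip L \<psi> \<in> ground_space L"
proof -
  have "H_FM L (conj_flip L \<psi>) = conj_flip L (H_FM L \<psi>)"
    by (simp add: conj_flip_H_FM[OF assms(1)])
  also have "H_FM L \<psi> = (\<lambda>\<sigma>. of_real (E_min_FM L) * \<psi> \<sigma>)"
    using assms(2) by (simp add: ground_space_def)
  finally show ?thesis
    using assms(2) by (simp add: ground_space_def conj_flip_singlets) (simp add: conj_flip_def)
qed

section \<open>The single mode approximation\<close>

definition fourier_weight :: "nat \<Rightarrow> int \<Rightarrow> nat \<Rightarrow> complex" where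
  "fourier_weight L l a = cis (2 * pi * l * a / L)"

lemma Shat_wop: "Shat L A l = wop L (fourier_weight L l) A"
  by (simp add: Shat_def wop_def fourier_weight_def cis_conv_exp fun_eq_iff mult_ac)

lemma fourier_weight_uminus: "fourier_weight L (- l) = (\<lambda>c. cnj (fourier_weight L l c))"
  by (simp add: fourier_weight_def cis_cnj fun_eq_iff)

lemma fourier_weight_next:
  assumes "a \<in> {1..L}"
  shows "fourier_weight L l (next_site L a) = fourier_weight L l a * cis (2 * pi * l / L)"
proof (cases "a = L")
  case True
  \<comment> \<open>The bond from \<open>L\<close> back to 1 follows the same rule as the others
    because \<open>l\<close> is an integer.\<close>
  have "cis (2 * pi * l) = 1"
    using cis_multiple_2pi[of "real_of_int l"] by simp
  then show ?thesis
    using True assms by (simp add: fourier_weight_def next_site_def)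
next
  case False
  then show ?thesis
    by (simp add: fourier_weight_def next_site_def cis_mult add_divide_distrib ring_distribs add.commute)
qed

text \<open>Neighbouring weights differ by a fixed phase, so the squared modulus is that of 1 -
  \<open>cis (2 * t)\<close>, the same on every bond.\<close>

lemma fourier_weight_diff:
  fixes L :: nat and l :: int
  assumes "a \<in> {1..L}"
  defines "d \<equiv> fourier_weight L l a - fourier_weight L l (next_site L a)"
  shows "d * cnj d = of_real (4 * (sin (pi * l / L))\<^sup>2)"
proof -
  define t where "t = pi * l / L"
  have "d = fourier_weight L l a * (1 - cis (2 * t))"
    by (simp add: d_def fourier_weight_next[OF assms(1)] t_def algebra_simps)
  then have "(cmod d)\<^sup>2 = (cmod (1 - cis (2 * t)))\<^sup>2"
    by (simp add: norm_mult fourier_weight_def)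
  also have "\<dots> = (1 - cos (2 * t))\<^sup>2 + (sin (2 * t))\<^sup>2"
    by (simp add: cmod_power2)
  also have "\<dots> = 2 - 2 * cos (2 * t)"
    using sin_cos_squared_add[of "2 * t"] by (simp add: power2_eq_square algebra_simps)
  also have "\<dots> = 4 * (sin t)\<^sup>2"
    by (simp add: cos_double_sin)
  finally show ?thesis
    unfolding t_def complex_norm_square[symmetric] by simp
qed

text \<open>By \<open>singlet_correlation\<close>, each of the two ladder terms of a bond, with its
  factor 1/2, contributes as much as the S3 term; this gives the factor 3.\<close>

lemma ground_energy:
  assumes L: "L \<ge> 2" and \<psi>: "\<psi> \<in> singlets L"
  shows "cip L \<psi> (H_FM L \<psi>) = of_nat L / 4 * cip L \<psi> \<psi>
    - 3 * (\<Sum>a\<in>{1..L}. cip L \<psi> (site_op S3 a (site_op S3 (next_site L a) \<psi>)))"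
proof -
  have "cip L \<psi> (bond a (next_site L a) \<psi>)
      = 1/4 * cip L \<psi> \<psi> - 3 * cip L \<psi> (site_op S3 a (site_op S3 (next_site L a) \<psi>))"
    if a: "a \<in> {1..L}" for a
  proof -
    define b where "b = next_site L a"
    have b: "b \<in> {1..L}" "a \<noteq> b"
      using next_site_props[OF L a] by (auto simp: b_def)
    \<comment> \<open>The second ladder product is reordered so that
      \<open>singlet_correlation\<close> applies to it with \<open>a\<close> and \<open>b\<close>
      exchanged.\<close>
    have "bond a b \<psi> = (\<lambda>\<sigma>. 1/4 * \<psi> \<sigma> - 1/2 * site_op Sminus a (site_op Splus b \<psi>) \<sigma>
        - 1/2 * site_op Sminus b (site_op Splus a \<psi>) \<sigma> - site_op S3 a (site_op S3 b \<psi>) \<sigma>)"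
      using b bond_ladder[of a b \<psi>] by (simp add: fun_eq_iff site_op_commute[of a b Splus])
    then show ?thesis
      using singlet_correlation[OF \<psi> a b] singlet_correlation[OF \<psi> b(1) a] b
      unfolding b_def[symmetric]
      by (simp add: cip_diff_right cip_scale_right site_op_commute[of b a S3] del: times_divide_eq_left)
  qed
  then show ?thesis
    by (simp add: H_FM_bond cip_sum_right sum_subtractf sum_distrib_left)
qed

text \<open>The inner commutator gives the weight difference on each bond, the outer one its
  conjugate. Each ladder term has twice the S3 correlation as its expectation, which together with
  the explicit 2 makes the factor 4.\<close>

lemma double_commutator:
  fixes w :: "nat \<Rightarrow> complex"
  assumes L: "L \<ge> 2" and \<psi>: "\<psi> \<in> singlets L"
  defines "w' \<equiv> \<lambda>c. cnj (w c)"
  defines "K \<equiv> \<lambda>\<phi> \<sigma>. H_FM L (wop L w Splus \<phi>) \<sigma> - wop L w Splus (H_FM L \<phi>) \<sigma>"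
  shows "cip L \<psi> (wop L w' Sminus (K \<psi>)) - cip L \<psi> (K (wop L w' Sminus \<psi>))
    = 4 * (\<Sum>a\<in>{1..L}. (w a - w (next_site L a)) * cnj (w a - w (next_site L a))
        * cip L \<psi> (site_op S3 a (site_op S3 (next_site L a) \<psi>)))"
proof -
  define B where "B = (\<lambda>a. bond_comm a (next_site L a))"
  have K: "K \<phi> = (\<lambda>\<sigma>. \<Sum>a\<in>{1..L}. (w a - w (next_site L a)) * B a \<phi> \<sigma>)" for \<phi>
    unfolding K_def B_def using H_FM_wop_Splus[OF L] by blast
  have "cip L \<psi> (wop L w' Sminus (K \<psi>)) - cip L \<psi> (K (wop L w' Sminus \<psi>))
    = (\<Sum>a\<in>{1..L}. (w a - w (next_site L a)) *
        cip L \<psi> (\<lambda>\<sigma>. wop L w' Sminus (B a \<psi>) \<sigma> - B a (wop L w' Sminus \<psi>) \<sigma>))"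
    unfolding K
    by (simp add: linop_sum[OF linop_wop] cip_sum_right cip_scale_right cip_diff_right
        sum_subtractf right_diff_distrib)
  also have "\<dots> = (\<Sum>a\<in>{1..L}. 4 * ((w a - w (next_site L a)) * cnj (w a - w (next_site L a))
        * cip L \<psi> (site_op S3 a (site_op S3 (next_site L a) \<psi>))))"
  proof (rule sum.cong)
    fix a assume a: "a \<in> {1..L}"
    define b where "b = next_site L a"
    have b: "b \<in> {1..L}" "a \<noteq> b"
      using next_site_props[OF L a] by (auto simp: b_def)
    have "(\<lambda>\<sigma>. wop L w' Sminus (B a \<psi>) \<sigma> - B a (wop L w' Sminus \<psi>) \<sigma>)
      = (\<lambda>\<sigma>. w' a * (site_op Sminus a (site_op Splus b \<psi>) \<sigma> + 2 * site_op S3 a (site_op S3 b \<psi>) \<sigma>)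
         - w' b * (site_op Sminus b (site_op Splus a \<psi>) \<sigma> + 2 * site_op S3 a (site_op S3 b \<psi>) \<sigma>))"
      unfolding B_def b_def[symmetric]
      by (subst wop_commutator[OF linop_bond_comm _ a b])
        (use b in \<open>auto simp: bond_comm_site_op_commute bond_comm_Sminus site_op_commute[of a b Splus]
            algebra_simps\<close>)
    then have "cip L \<psi> (\<lambda>\<sigma>. wop L w' Sminus (B a \<psi>) \<sigma> - B a (wop L w' Sminus \<psi>) \<sigma>)
      = 4 * cnj (w a - w b) * cip L \<psi> (site_op S3 a (site_op S3 b \<psi>))"
      using singlet_correlation[OF \<psi> a b] singlet_correlation[OF \<psi> b(1) a] b
      by (simp add: cip_diff_right cip_add_right cip_scale_right site_op_commute[of b a S3] w'_def
          algebra_simps)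
    then show "(w a - w (next_site L a)) *
        cip L \<psi> (\<lambda>\<sigma>. wop L w' Sminus (B a \<psi>) \<sigma> - B a (wop L w' Sminus \<psi>) \<sigma>)
      = 4 * ((w a - w (next_site L a)) * cnj (w a - w (next_site L a))
        * cip L \<psi> (site_op S3 a (site_op S3 (next_site L a) \<psi>)))"
      unfolding b_def by (simp only: mult_ac)
  qed simp
  finally show ?thesis
    by (simp add: sum_distrib_left)
qed

theorem corollary2p4:
  fixes L :: nat and l :: int and \<Theta> :: state
  assumes "even L" and "L > 0"
    and "ground_space L = range (\<lambda>c \<sigma>. c * \<Theta> \<sigma>)"
    and "hnorm L \<Theta> = 1"
    and "l \<in> {1..int L - 1}"
  shows "E_SMA L \<Theta> l =
    complex_of_real (8 / 3 * (real L / 4 - E_min_FM L)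
      * ((sin (pi * real_of_int l / real L))\<^sup>2 / (hnorm L (Shat_plus L l \<Theta>))\<^sup>2))"
proof -
  \<comment> \<open>Evenness excludes \<open>L = 1\<close>, where a bond would join a site to
    itself.\<close>
  have L: "L \<ge> 2"
    using assms(1,2) by (auto elim: evenE)
  define E where "E = complex_of_real (E_min_FM L)"
  define w where "w = fourier_weight L l"
  define A where "A = wop L w Splus"
  define A' where "A' = wop L (\<lambda>c. cnj (w c)) Sminus"
  define D where "D = (\<lambda>\<psi> \<sigma>. H_FM L \<psi> \<sigma> - E * \<psi> \<sigma>)"
  define s where "s = complex_of_real ((sin (pi * l / L))\<^sup>2)"
  define z where "z = (\<Sum>a\<in>{1..L}. cip L \<Theta> (site_op S3 a (site_op S3 (next_site L a) \<Theta>)))"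

  have "\<Theta> = (\<lambda>\<sigma>. 1 * \<Theta> \<sigma>)"
    by simp
  then have \<Theta>: "\<Theta> \<in> ground_space L"
    unfolding assms(3) by blast
  then have singlet: "\<Theta> \<in> singlets L" and H: "H_FM L \<Theta> = (\<lambda>\<sigma>. E * \<Theta> \<sigma>)"
    by (simp_all add: ground_space_def E_def)
  have norm: "cip L \<Theta> \<Theta> = 1"
    by (simp add: cip_self_hnorm assms(4))
  have cip_D: "cip L \<phi> (D \<psi>) = cip L (D \<phi>) \<psi>" for \<phi> \<psi>
    unfolding D_def
    by (simp add: cip_diff_left cip_diff_right cip_scale_left cip_scale_right cip_H_FM[OF L] E_def)
  have D: "linop D"
    unfolding D_def by (intro linop_minus_op linop_H_FM linop_scale_op linop_id)
  have adjoint: "cip L \<phi> (A' \<psi>) = cip L (A \<phi>) \<psi>" "cip L \<phi> (A \<psi>) = cip L (A' \<phi>) \<psi>" for \<phi> \<psi>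
    by (simp_all add: A_def A'_def cip_wop adj2_spin)

  \<comment> \<open>One-dimensionality of the ground space enters here: the symmetry can only
    multiply \<Theta> by a scalar, which has modulus 1 because norms are preserved.\<close>
  have "conj_flip L \<Theta> \<in> range (\<lambda>c \<sigma>. c * \<Theta> \<sigma>)"
    using conj_flip_ground_space[OF L \<Theta>] assms(3) by simp
  then obtain c where c: "conj_flip L \<Theta> = (\<lambda>\<sigma>. c * \<Theta> \<sigma>)"
    by blast
  have "cnj c * c = 1"
    using cip_conj_flip[of L \<Theta> \<Theta>] by (simp add: c cip_scale_left cip_scale_right norm)
  moreover have "conj_flip L (A \<Theta>) = (\<lambda>\<sigma>. c * A' \<Theta> \<sigma>)"
    by (simp add: A_def A'_def conj_flip_wop conj_flip2_spin c linop_scale[OF linop_wop])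
  moreover have "conj_flip L (D (A \<Theta>)) = D (conj_flip L (A \<Theta>))"
    by (simp add: D_def conj_flip_H_FM[OF L, symmetric]) (simp add: conj_flip_def E_def)
  ultimately have "cip L (A' \<Theta>) (D (A' \<Theta>)) = cnj (cip L (A \<Theta>) (D (A \<Theta>)))"
    by (simp add: cip_conj_flip[symmetric] linop_scale[OF D] cip_scale_left cip_scale_right
        flip: mult.assoc)
  then have symmetric: "cip L (A' \<Theta>) (D (A' \<Theta>)) = cip L (A \<Theta>) (D (A \<Theta>))"
    by (simp add: cip_cnj cip_D)

  define K where "K = (\<lambda>\<phi> \<sigma>. H_FM L (A \<phi>) \<sigma> - A (H_FM L \<phi>) \<sigma>)"
  \<comment> \<open>Since \<Theta> is an eigenvector, the commutator acts on it as \<open>D\<close>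
    after \<open>A\<close>. Against \<Theta> on the left the same argument yields a minus sign, so
    the two halves of the double commutator add up.\<close>
  have "K \<Theta> = D (A \<Theta>)"
    by (simp add: K_def D_def H A_def linop_scale[OF linop_wop])
  moreover have "cip L \<Theta> (K (A' \<Theta>)) = - cip L (A' \<Theta>) (D (A' \<Theta>))"
    by (simp add: K_def D_def cip_diff_right cip_scale_right cip_H_FM[OF L, of \<Theta>] adjoint H
        cip_scale_left E_def)
  ultimately have "2 * cip L (A \<Theta>) (D (A \<Theta>)) = cip L \<Theta> (A' (K \<Theta>)) - cip L \<Theta> (K (A' \<Theta>))"
    by (simp add: adjoint symmetric)
  also have "\<dots> = 4 * (\<Sum>a\<in>{1..L}. (w a - w (next_site L a)) * cnj (w a - w (next_site L a))
        * cip L \<Theta> (site_op S3 a (site_op S3 (next_site L a) \<Theta>)))"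
    unfolding K_def A_def A'_def by (rule double_commutator[OF L singlet])
  also have "\<dots> = 4 * (\<Sum>a\<in>{1..L}. 4 * s * cip L \<Theta> (site_op S3 a (site_op S3 (next_site L a) \<Theta>)))"
    using fourier_weight_diff[of _ L l] by (simp add: w_def s_def)
  also have "\<dots> = 16 * s * z"
    by (simp add: z_def sum_distrib_left mult.assoc)
  finally have sz: "cip L (A \<Theta>) (D (A \<Theta>)) = 8 * s * z"
    by simp
  \<comment> \<open>The energy itself determines the bond correlation sum \<open>z\<close>;
    eliminating it turns the factor 8 into 8/3.\<close>
  have z: "of_nat L / 4 - E = 3 * z"
    using ground_energy[OF L singlet] by (simp add: H cip_scale_right norm z_def)
  have "cip L (A \<Theta>) (D (A \<Theta>)) = 8 / 3 * (of_nat L / 4 - E) * s"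
    unfolding z by (simp add: sz)
  moreover have "cip L \<Theta> (A' (D (A \<Theta>))) = cip L (A \<Theta>) (D (A \<Theta>))"
    by (rule adjoint)
  moreover have "E_SMA L \<Theta> l = cip L \<Theta> (A' (D (A \<Theta>))) / of_real ((hnorm L (A \<Theta>))\<^sup>2)"
    by (simp add: E_SMA_def Shat_wop fourier_weight_uminus A_def A'_def D_def E_def w_def)
  \<comment> \<open>Only numerators are compared; if the common denominator is 0, both quotients are
    0.\<close>
  ultimately have "E_SMA L \<Theta> l
      = 8 / 3 * (of_nat L / 4 - E) * s / of_real ((hnorm L (Shat_plus L l \<Theta>))\<^sup>2)"
    by (simp only: A_def w_def Shat_wop)
  then show ?thesis
    by (simp add: E_def s_def)
qed

end
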